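(* Let $T=(V,E,\mathbf 1_r)$ be a root-reward tree, $\lambda\in(0,\infty)$ and $v\in O$. For $\epsilon\in(0,1]$, the value of the mean $\mathbb E\,\mathrm{TotVar}(\epsilon,\lambda,\theta,v)$ is independent of $\theta\in\Theta$; denote it by $\mathbb E\,\mathrm{TotVar}(\epsilon,\lambda,v)$. Then $\mathbb E\,\mathrm{TotVar}(\epsilon,\lambda,v)=\epsilon^{-1}(\lambda+1)^2\frac{\partial}{\partial\lambda}h(\lambda,v)$ for $\epsilon\in(0,1]$. As such, for $\epsilon\in(0,1]$, $$\mathrm{Stake}(\epsilon,\lambda,v)=\frac{\Delta(\lambda,v)}{\mathbb E\,\mathrm{TotVar}(\epsilon,\lambda,v)}=\frac{\epsilon\,\Delta(\lambda,v)}{\mathbb E\,\mathrm{TotVar}(1,\lambda,v)}.$$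
   Context: A root-reward tree $(V,E,\mathbf 1_r)$ consists of a finite rooted tree $(V,E)$ whose root $r$ is a leaf; $B$ is the set of all leaves (including $r$), $B^*=B\setminus\{r\}$, $O=V\setminus B$ is non-empty, and $p=\mathbf 1_r:B\to\{0,1\}$. Write $u\sim v$ for adjacency. $d_{\rm out}(v)$ is the minimum length of a path from $v$ to $B^*$ each of whose edges leads away from $r$. For $v\ne r$, $v_+$ is the parent of $v$. For $v\in V\setminus B^*$, $\mathcal V_-(v)$ is the set of children $u$ of $v$ with $d_{\rm out}(u)=d_{\rm out}(v)-1$. For $\lambda\in(0,\infty)$, $h(\lambda,\cdot):V\to[0,\infty)$ is the unique solution of: $h(\lambda,v)=p(v)$ for $v\in B$, and $h(\lambda,v)=\frac{\lambda}{\lambda+1}\max_{u\sim v}h(\lambda,u)+\frac1{\lambda+1}\min_{u\sim v}h(\lambda,u)$ for $v\in O$; it is differentiable in $\lambda\in(0,\infty)$. Set $\Delta(\lambda,v)=\max_{w\sim v}h(\lambda,w)-\min_{w\sim v}h(\lambda,w)$ and $\mathrm{Stake}(\epsilon,\lambda,v)=\dfrac{\epsilon\,\Delta(\lambda,v)}{(\lambda+1)^2\frac{\partial}{\partial\lambda}h(\lambda,v)}$ for $v\in O$. $\Theta$ is the set of maps $\theta:(0,\infty)\times O\times\{0,1,2,\dots\}\to V$ with $\theta(\lambda,v,i)\in\mathcal V_-(v)$. For $\theta\in\Theta$, $X_\theta=X_\theta(\epsilon,\lambda,\cdot)$ is the Markov process with $X_\theta(0)=v$ such that, when $X_\theta(k)\in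 O$: $X_\theta(k+1)=X_\theta(k)$ with probability $1-\epsilon$; $=(X_\theta(k))_+$ with probability $\epsilon\frac{\lambda}{1+\lambda}$; $=\theta(\lambda,X_\theta(k),k)$ with probability $\epsilon\frac1{1+\lambda}$. It is stopped at $F_\theta=\min\{j\ge0:X_\theta(j)\in B\}$. Set $\mathrm{TotVar}(\epsilon,\lambda,\theta,v)=\sum_{i=0}^{F_\theta-1}\Delta(\lambda,X_\theta(i))$. *)

theory Defs
  imports "HOL-Probability.Probability" "HOL-Library.Extended_Nat"
begin

section \<open>Root-reward trees\<close>

text \<open>A graph is a pair of a vertex set \<open>V :: 'v set\<close> and a set \<open>E :: 'v set set\<close> of
  two-element subsets of \<open>V\<close>. Paths are lists of pairwise distinct vertices.\<close>

definition nbrs :: "'v set set \<Rightarrow> 'v \<Rightarrow> 'v set" where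
  "nbrs E v = {u. {u, v} \<in> E}"

definition is_path :: "'v set \<Rightarrow> 'v set set \<Rightarrow> 'v list \<Rightarrow> bool" where
  "is_path V E xs \<longleftrightarrow> xs \<noteq> [] \<and> set xs \<subseteq> V \<and> distinct xs \<and> successively (\<lambda>a b. {a, b} \<in> E) xs"

definition finite_tree :: "'v set \<Rightarrow> 'v set set \<Rightarrow> bool" where
  "finite_tree V E \<longleftrightarrow>
     finite V \<and> V \<noteq> {} \<and> (\<forall>e\<in>E. \<exists>a\<in>V. \<exists>b\<in>V. a \<noteq> b \<and> e = {a, b}) \<and>
     (\<forall>u\<in>V. \<forall>w\<in>V. \<exists>!xs. is_path V E xs \<and> hd xs = u \<and> last xs = w)"

definition leaves :: "'v set \<Rightarrow> 'v set set \<Rightarrow> 'v set" where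
  "leaves V E = {v \<in> V. card (nbrs E v) = 1}"

definition open_vertices :: "'v set \<Rightarrow> 'v set set \<Rightarrow> 'v set" where
  "open_vertices V E = V - leaves V E"

text \<open>The reward function of a root-reward tree is the indicator of the root, so the tree is
  given by \<open>V\<close>, \<open>E\<close> and the root \<open>r\<close>.\<close>

definition root_reward_tree :: "'v set \<Rightarrow> 'v set set \<Rightarrow> 'v \<Rightarrow> bool" where
  "root_reward_tree V E r \<longleftrightarrow>
     finite_tree V E \<and> r \<in> leaves V E \<and> open_vertices V E \<noteq> {}"

definition reward :: "'v \<Rightarrow> 'v \<Rightarrow> real" where
  "reward r v = (if v = r then 1 else 0)"

text \<open>The parent of \<open>v \<noteq> r\<close> is the second vertex of the path from \<open>v\<close> to \<open>r\<close>.\<close>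

definition parent :: "'v set \<Rightarrow> 'v set set \<Rightarrow> 'v \<Rightarrow> 'v \<Rightarrow> 'v" where
  "parent V E r v = (THE u. \<exists>xs. is_path V E (v # u # xs) \<and> last (v # u # xs) = r)"

definition children :: "'v set \<Rightarrow> 'v set set \<Rightarrow> 'v \<Rightarrow> 'v \<Rightarrow> 'v set" where
  "children V E r v = {u \<in> V - {r}. parent V E r u = v}"

definition d_out :: "'v set \<Rightarrow> 'v set set \<Rightarrow> 'v \<Rightarrow> 'v \<Rightarrow> nat" where
  "d_out V E r v =
     (LEAST n. \<exists>xs. length xs = Suc n \<and> is_path V E xs \<and>
        successively (\<lambda>a b. b \<in> children V E r a) xs \<and>
        hd xs = v \<and> last xs \<in> leaves V E - {r})"

definition V_minus :: "'v set \<Rightarrow> 'v set set \<Rightarrow> 'v \<Rightarrow> 'v \<Rightarrow> 'v set" where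
  "V_minus V E r v = {u \<in> children V E r v. d_out V E r u + 1 = d_out V E r v}"


section \<open>The value function and the stake\<close>

definition biased_infinity_harmonic ::
    "'v set \<Rightarrow> 'v set set \<Rightarrow> 'v \<Rightarrow> real \<Rightarrow> ('v \<Rightarrow> real) \<Rightarrow> bool" where
  "biased_infinity_harmonic V E r l f \<longleftrightarrow>
     (\<forall>v\<in>leaves V E. f v = reward r v) \<and>
     (\<forall>v\<in>open_vertices V E.
        f v = l / (l + 1) * Max (f ` nbrs E v) + 1 / (l + 1) * Min (f ` nbrs E v))"

text \<open>Functions on \<open>V\<close> are made unique outside \<open>V\<close> by extensionality.\<close>

definition h :: "'v set \<Rightarrow> 'v set set \<Rightarrow> 'v \<Rightarrow> real \<Rightarrow> 'v \<Rightarrow> real" where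
  "h V E r l = (THE f. f \<in> V \<rightarrow>\<^sub>E {0..} \<and> biased_infinity_harmonic V E r l f)"

definition Delta :: "'v set \<Rightarrow> 'v set set \<Rightarrow> 'v \<Rightarrow> real \<Rightarrow> 'v \<Rightarrow> real" where
  "Delta V E r l v = Max (h V E r l ` nbrs E v) - Min (h V E r l ` nbrs E v)"

definition Stake :: "'v set \<Rightarrow> 'v set set \<Rightarrow> 'v \<Rightarrow> real \<Rightarrow> real \<Rightarrow> 'v \<Rightarrow> real" where
  "Stake V E r \<epsilon> l v =
     \<epsilon> * Delta V E r l v / ((l + 1)\<^sup>2 * deriv (\<lambda>l. h V E r l v) l)"


section \<open>The process and its total variation\<close>

text \<open>Only the values of \<open>\<theta>\<close> on \<open>(0,\<infinity>) \<times> O \<times> {0,1,2,\<dots>}\<close> are constrained; nothing below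
  looks at the others.\<close>

definition Theta :: "'v set \<Rightarrow> 'v set set \<Rightarrow> 'v \<Rightarrow> (real \<Rightarrow> 'v \<Rightarrow> nat \<Rightarrow> 'v) set" where
  "Theta V E r =
     {\<theta>. \<forall>l>0. \<forall>v\<in>open_vertices V E. \<forall>i. \<theta> l v i \<in> V_minus V E r v}"

text \<open>\<open>X\<close> is a realization of \<open>X\<^sub>\<theta>\<close> from \<open>v\<close> on the probability space \<open>M\<close>: given any history
  \<open>x 0, \<dots>, x k\<close> of positive probability with \<open>x k \<in> O\<close>, the next step has the stated law;
  after reaching the boundary the process stays put. The three targets \<open>x k\<close>, its
  parent and a child of it are distinct and the three probabilities sum to one, so this
  determines the joint law of the process.\<close>

definition theta_process ::
    "'v set \<Rightarrow> 'v set set \<Rightarrow> 'v \<Rightarrow> real \<Rightarrow> real \<Rightarrow> (real \<Rightarrow> 'v \<Rightarrow> nat \<Rightarrow> 'v) \<Rightarrow> 'v \<Rightarrow>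
     'w measure \<Rightarrow> (nat \<Rightarrow> 'w \<Rightarrow> 'v) \<Rightarrow> bool" where
  "theta_process V E r \<epsilon> l \<theta> v M X \<longleftrightarrow>
     prob_space M \<and>
     (\<forall>k. X k \<in> M \<rightarrow>\<^sub>M count_space V) \<and>
     (AE \<omega> in M. X 0 \<omega> = v) \<and>
     (\<forall>k x. x k \<in> open_vertices V E \<and> \<P>(\<omega> in M. \<forall>i\<le>k. X i \<omega> = x i) > 0 \<longrightarrow>
        \<P>(\<omega> in M. X (Suc k) \<omega> = x k \<bar> \<forall>i\<le>k. X i \<omega> = x i) = 1 - \<epsilon> \<and>
        \<P>(\<omega> in M. X (Suc k) \<omega> = parent V E r (x k) \<bar> \<forall>i\<le>k. X i \<omega> = x i) = \<epsilon> * (l / (1 + l)) \<and>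
        \<P>(\<omega> in M. X (Suc k) \<omega> = \<theta> l (x k) k \<bar> \<forall>i\<le>k. X i \<omega> = x i) = \<epsilon> * (1 / (1 + l))) \<and>
     (\<forall>k. AE \<omega> in M. X k \<omega> \<in> leaves V E \<longrightarrow> X (Suc k) \<omega> = X k \<omega>)"

text \<open>The infimum of the empty set is \<open>\<infinity>\<close>: this is the value if the boundary is never reached.\<close>

definition finish_time :: "'v set \<Rightarrow> 'v set set \<Rightarrow> (nat \<Rightarrow> 'w \<Rightarrow> 'v) \<Rightarrow> 'w \<Rightarrow> enat" where
  "finish_time V E X \<omega> = (INF j\<in>{j. X j \<omega> \<in> leaves V E}. enat j)"

definition TotVar ::
    "'v set \<Rightarrow> 'v set set \<Rightarrow> 'v \<Rightarrow> real \<Rightarrow> (nat \<Rightarrow> 'w \<Rightarrow> 'v) \<Rightarrow> 'w \<Rightarrow> ennreal" where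
  "TotVar V E r l X \<omega> =
     (\<Sum>i. if enat i < finish_time V E X \<omega> then ennreal (Delta V E r l (X i \<omega>)) else 0)"

definition mean_TotVar ::
    "'v set \<Rightarrow> 'v set set \<Rightarrow> 'v \<Rightarrow> real \<Rightarrow> 'w measure \<Rightarrow> (nat \<Rightarrow> 'w \<Rightarrow> 'v) \<Rightarrow> ennreal" where
  "mean_TotVar V E r l M X = (\<integral>\<^sup>+\<omega>. TotVar V E r l X \<omega> \<partial>M)"


section \<open>Existence of the process\<close>

lemma parent_eqI:
  assumes T: "finite_tree V E" and "r \<in> V"
    and p: "is_path V E (v # u # xs)" "last (v # u # xs) = r"
  shows "parent V E r v = u"
  unfolding parent_def
proof (rule the_equality)
  show "\<exists>xs. is_path V E (v # u # xs) \<and> last (v # u # xs) = r" using p by blast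
next
  fix u' assume "\<exists>xs. is_path V E (v # u' # xs) \<and> last (v # u' # xs) = r"
  then obtain ys where q: "is_path V E (v # u' # ys)" "last (v # u' # ys) = r" by blast
  have "v \<in> V" using p by (simp add: is_path_def)
  then have "\<exists>!xs. is_path V E xs \<and> hd xs = v \<and> last xs = r"
    using T \<open>r \<in> V\<close> by (auto simp: finite_tree_def)
  then have "v # u' # ys = v # u # xs" using p q by (metis list.sel(1))
  then show "u' = u" by simp
qed

lemma parent_path:
  assumes T: "finite_tree V E" and "r \<in> V" "v \<in> V" "v \<noteq> r"
  obtains xs where "is_path V E (v # parent V E r v # xs)" "last (v # parent V E r v # xs) = r"
proof -
  obtain xs where xs: "is_path V E xs" "hd xs = v" "last xs = r"
    using T \<open>r \<in> V\<close> \<open>v \<in> V\<close> unfolding finite_tree_def by metis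
  then obtain u ys where "xs = v # u # ys"
    using \<open>v \<noteq> r\<close> by (cases xs; cases "tl xs") (auto simp: is_path_def)
  with xs parent_eqI[OF T \<open>r \<in> V\<close>] that show thesis by metis
qed

lemma parent_in:
  assumes "finite_tree V E" and "r \<in> V" "v \<in> V" "v \<noteq> r"
  shows "parent V E r v \<in> V" "parent V E r v \<noteq> v"
proof -
  obtain xs where "is_path V E (v # parent V E r v # xs)"
    using parent_path[OF assms] by blast
  then show "parent V E r v \<in> V" "parent V E r v \<noteq> v" by (auto simp: is_path_def)
qed

lemma child_neq:
  assumes T: "finite_tree V E" and r: "r \<in> V" and v: "v \<in> V" "v \<noteq> r" and c: "c \<in> children V E r v"
  shows "c \<in> V" "c \<noteq> v" "c \<noteq> parent V E r v"
proof -
  show "c \<in> V" using c by (auto simp: children_def)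
  have pc: "parent V E r c = v" "c \<noteq> r" using c by (auto simp: children_def)
  show "c \<noteq> v" using parent_in[OF T r \<open>c \<in> V\<close> \<open>c \<noteq> r\<close>] pc by simp
  show "c \<noteq> parent V E r v"
  proof
    assume a: "c = parent V E r v"
    obtain xs where xs: "is_path V E (v # c # xs)" "last (v # c # xs) = r"
      using parent_path[OF T r v] unfolding a by blast
    then obtain w ys where w: "xs = w # ys" using pc by (cases xs) auto
    have "is_path V E (c # w # ys)" "last (c # w # ys) = r"
      using xs w by (auto simp: is_path_def)
    from parent_eqI[OF T r this] pc have "w = v" by simp
    then show False using xs w by (simp add: is_path_def)
  qed
qed

text \<open>A path as a function of an independent sequence of moves \<open>w\<close>.\<close>

fun drive :: "('v \<Rightarrow> nat \<Rightarrow> nat \<Rightarrow> 'v) \<Rightarrow> 'v \<Rightarrow> nat \<Rightarrow> (nat \<Rightarrow> nat) \<Rightarrow> 'v" where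
  "drive g v 0 w = v"
| "drive g v (Suc k) w = g (drive g v k w) k (w k)"

lemma drive_cong: "(\<And>i. i < k \<Longrightarrow> w i = w' i) \<Longrightarrow> drive g v k w = drive g v k w'"
  by (induction k) auto

lemma drive_measurable:
  assumes fin: "finite V" and v: "v \<in> V" and g: "\<And>x k j. x \<in> V \<Longrightarrow> g x k j \<in> V" and "k \<le> n"
  shows "drive g v k \<in> PiM {..<n} (\<lambda>_. count_space UNIV) \<rightarrow>\<^sub>M count_space V"
  using \<open>k \<le> n\<close>
proof (induction k)
  case 0 then show ?case using v by simp
next
  case (Suc k)
  have 1: "drive g v k \<in> PiM {..<n} (\<lambda>_. count_space UNIV) \<rightarrow>\<^sub>M count_space V" using Suc by simp
  have 2: "(\<lambda>w. w k) \<in> PiM {..<n} (\<lambda>_. count_space UNIV) \<rightarrow>\<^sub>M count_space (UNIV::nat set)"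
    using Suc by (intro measurable_component_singleton) auto
  have "(\<lambda>w. g (drive g v k w) k (w k)) \<in> PiM {..<n} (\<lambda>_. count_space UNIV) \<rightarrow>\<^sub>M count_space V"
  proof (rule measurable_compose_countable'[where I=V and g="drive g v k" 
        and f = "\<lambda>x w. g x k (w k)"])
    fix x assume "x \<in> V"
    show "(\<lambda>w. g x k (w k)) \<in> PiM {..<n} (\<lambda>_. count_space UNIV) \<rightarrow>\<^sub>M count_space V"
      using measurable_compose[OF 2, of "\<lambda>j. g x k j" "count_space V"] g[OF \<open>x \<in> V\<close>] by simp
  qed (use 1 fin in \<open>auto intro: countable_finite\<close>)
  then show ?case by simp
qed

lemma theta_process_exists:
  fixes V :: "'v set"
  assumes T: "root_reward_tree V E r" and l: "0 < l" and v: "v \<in> open_vertices V E"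
    and e: "0 < \<epsilon>" "\<epsilon> \<le> 1" and th: "\<theta> \<in> Theta V E r"
  shows "\<exists>(M :: (nat \<Rightarrow> nat) measure) X. theta_process V E r \<epsilon> l \<theta> v M X"
proof -
  have FT: "finite_tree V E" and rV: "r \<in> V" and finV: "finite V"
    using T by (simp_all add: root_reward_tree_def leaves_def, simp add: finite_tree_def)
  have O: "x \<in> V" "x \<noteq> r" if "x \<in> open_vertices V E" for x
    using that T unfolding open_vertices_def root_reward_tree_def by blast+
  define g where "g x k j = (if x \<in> open_vertices V E then
     (if j = 0 then x else if j = Suc 0 then parent V E r x else \<theta> l x k) else x)" for x k and j::nat
  have thc: "\<theta> l x k \<in> children V E r x" if "x \<in> open_vertices V E" for x k
    using th l that by (auto simp: Theta_def V_minus_def)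
  have gV: "g x k j \<in> V" if "x \<in> V" for x k j
    using that O[of x] parent_in[OF FT rV, of x] child_neq(1)[OF FT rV _ _ thc, of x k]
    unfolding g_def by (simp split: if_splits)
  define q :: "nat pmf" where "q = bind_pmf (bernoulli_pmf \<epsilon>) (\<lambda>b. bind_pmf (bernoulli_pmf (l/(1+l)))
      (\<lambda>c. return_pmf (if b then if c then 1 else 2 else 0)))"
  have lp: "0 \<le> l/(1+l)" "l/(1+l) \<le> 1" using l by auto
  have p0: "pmf q 0 = 1 - \<epsilon>" and p1: "pmf q 1 = \<epsilon> * (l/(1+l))"
    using e lp by (simp_all add: q_def pmf_bind)
  have q0: "measure_pmf.prob q {0} = 1 - \<epsilon>" and q1: "measure_pmf.prob q {1} = \<epsilon> * (l/(1+l))"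
    using p0 p1 by (simp_all add: measure_pmf_single)
  have q2: "measure_pmf.prob q {2..} = \<epsilon> * (1/(1+l))"
  proof -
    have "{2..} = UNIV - {0, 1::nat}" by auto
    then have "measure_pmf.prob q {2..} = 1 - measure_pmf.prob q {0, 1}"
      using measure_pmf.prob_compl[of "{0,1}" q] by simp
    also have "measure_pmf.prob q {0, 1} = pmf q 0 + pmf q 1"
      by (simp add: measure_measure_pmf_finite)
    also have "1 - (pmf q 0 + pmf q 1) = \<epsilon> * (1 - l/(1+l))"
      by (simp add: p0 p1[simplified] algebra_simps)
    also have "1 - l/(1+l) = 1/(1+l)" using l by (simp add: field_simps)
    finally show ?thesis .
  qed
  define M where "M = PiM (UNIV::nat set) (\<lambda>_. measure_pmf q)"
  interpret M: product_prob_space "\<lambda>_::nat. measure_pmf q" UNIV ..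
  interpret P: prob_space M unfolding M_def by (rule M.prob_space_axioms)
  define X where "X k w = drive g v k w" for k w
  have spM: "space M = UNIV" by (auto simp: M_def space_PiM)
  have coord: "(\<lambda>w. w i) \<in> M \<rightarrow>\<^sub>M measure_pmf q" for i
    unfolding M_def by (rule measurable_component_singleton) simp
  have ind: "P.indep_vars (\<lambda>_. measure_pmf q) (\<lambda>i w. w i) UNIV"
  proof (subst P.indep_vars_iff_distr_eq_PiM)
    have "distr M (PiM UNIV (\<lambda>_. measure_pmf q)) (\<lambda>x. x) = M"
      unfolding M_def by (rule distr_id)
    moreover have "distr M (measure_pmf q) (\<lambda>w. w i) = measure_pmf q" for i
      unfolding M_def by (rule M.PiM_component) simp
    ultimately show "distr M (PiM UNIV (\<lambda>_. measure_pmf q)) (\<lambda>x. \<lambda>i\<in>UNIV. x i) =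
       PiM UNIV (\<lambda>i. distr M (measure_pmf q) (\<lambda>w. w i))"
      by (simp add: M_def restrict_def)
  qed (use coord in auto)
  have indk: "P.prob {w. A (\<lambda>i\<in>{..<k}. w i) \<and> w k \<in> S} = P.prob {w. A (\<lambda>i\<in>{..<k}. w i)} * measure_pmf.prob q S"
    if A: "{w \<in> space (PiM {..<k} (\<lambda>_. measure_pmf q)). A w} \<in> sets (PiM {..<k} (\<lambda>_. measure_pmf q))" for A k S
  proof -
    have "P.indep_var (PiM {..<k} (\<lambda>_. measure_pmf q)) (\<lambda>w. restrict (\<lambda>i. w i) {..<k})
              (PiM {k} (\<lambda>_. measure_pmf q)) (\<lambda>w. restrict (\<lambda>i. w i) {k})"
      by (rule P.indep_var_restrict[OF ind]) auto
    note iv = this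
    have B: "{w \<in> space (PiM {k} (\<lambda>_. measure_pmf q)). w k \<in> S} \<in> sets (PiM {k} (\<lambda>_. measure_pmf q))"
      by (rule sets_Collect_single) auto
    from P.indep_varD[OF iv A B]
    have "P.prob {w. A (\<lambda>i\<in>{..<k}. w i) \<and> w k \<in> S} = P.prob {w. A (\<lambda>i\<in>{..<k}. w i)} * P.prob ((\<lambda>w. w k) -` S \<inter> space M)"
      by (simp add: vimage_def spM space_PiM)
    also have "P.prob ((\<lambda>w. w k) -` S \<inter> space M) = measure (distr M (measure_pmf q) (\<lambda>w. w k)) S"
      using coord by (simp add: measure_distr)
    also have "distr M (measure_pmf q) (\<lambda>w. w k) = measure_pmf q"
      unfolding M_def by (rule M.PiM_component) simp
    finally show ?thesis .
  qed
  have sPi: "sets (PiM J (\<lambda>_. measure_pmf q)) = sets (PiM J (\<lambda>_. count_space UNIV))" for J :: "nat set"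
    by (rule sets_PiM_cong) auto
  have vV: "v \<in> V" using O v by auto
  have Xrestr: "X k (\<lambda>i\<in>{..<n}. w i) = X k w" if "k \<le> n" for k n w
    unfolding X_def by (rule drive_cong) (use that in auto)
  have drm: "X k \<in> PiM {..<n} (\<lambda>_. measure_pmf q) \<rightarrow>\<^sub>M count_space V" if "k \<le> n" for k n
    using drive_measurable[of V v g k n] finV vV gV that
    by (simp add: X_def[abs_def] measurable_cong_sets[OF sPi refl])
  have Xm: "X k \<in> M \<rightarrow>\<^sub>M count_space V" for k
  proof -
    have "(\<lambda>w. restrict w {..<k}) \<in> M \<rightarrow>\<^sub>M PiM {..<k} (\<lambda>_. measure_pmf q)"
      unfolding M_def by (rule measurable_restrict_subset) auto
    from measurable_compose[OF this drm[OF order_refl]] show ?thesis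
      by (simp add: Xrestr)
  qed
  have hist: "P.prob {w. (\<forall>i\<le>k. X i w = x i) \<and> w k \<in> S} = P.prob {w. \<forall>i\<le>k. X i w = x i} * measure_pmf.prob q S" for k x S
  proof -
    have "{w \<in> space (PiM {..<k} (\<lambda>_. measure_pmf q)). \<forall>i\<in>{..k}. X i w = x i} \<in> sets (PiM {..<k} (\<lambda>_. measure_pmf q))"
    proof (rule sets.sets_Collect_finite_All)
      fix i assume "i \<in> {..k}"
      have "X i -` ({x i} \<inter> V) \<inter> space (PiM {..<k} (\<lambda>_. measure_pmf q)) \<in> sets (PiM {..<k} (\<lambda>_. measure_pmf q))"
        using \<open>i \<in> {..k}\<close> by (intro measurable_sets[OF drm]) auto
      also have "X i -` ({x i} \<inter> V) \<inter> space (PiM {..<k} (\<lambda>_. measure_pmf q)) = {w \<in> space (PiM {..<k} (\<lambda>_. measure_pmf q)). X i w = x i}"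
        using measurable_space[OF drm[of i k]] \<open>i \<in> {..k}\<close> by auto
      finally show "{w \<in> space (PiM {..<k} (\<lambda>_. measure_pmf q)). X i w = x i} \<in> sets (PiM {..<k} (\<lambda>_. measure_pmf q))" .
    qed simp
    from indk[OF this, of S] show ?thesis
      by (simp add: Ball_def Xrestr cong: conj_cong imp_cong)
  qed
  have cond: "\<P>(w in M. X (Suc k) w = y \<bar> \<forall>i\<le>k. X i w = x i) = measure_pmf.prob q S"
    if x: "P.prob {w. \<forall>i\<le>k. X i w = x i} > 0" and S: "\<And>j. g (x k) k j = y \<longleftrightarrow> j \<in> S" for k x y S
  proof -
    have "{w. X (Suc k) w = y \<and> (\<forall>i\<le>k. X i w = x i)} = {w. (\<forall>i\<le>k. X i w = x i) \<and> w k \<in> S}"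
    proof -
      have "X (Suc k) w = y \<longleftrightarrow> w k \<in> S" if "\<forall>i\<le>k. X i w = x i" for w
        using that S by (simp add: X_def)
      then show ?thesis by blast
    qed
    then show ?thesis using x hist[of k x S] by (simp add: cond_prob_def spM)
  qed
  have "theta_process V E r \<epsilon> l \<theta> v M X"
    unfolding theta_process_def
  proof (intro conjI allI impI; (elim conjE)?)
    show "prob_space M" by (rule P.prob_space_axioms)
    show "X k \<in> M \<rightarrow>\<^sub>M count_space V" for k by (rule Xm)
    show "AE w in M. X 0 w = v" by (simp add: X_def)
    show "AE w in M. X k w \<in> leaves V E \<longrightarrow> X (Suc k) w = X k w" for k
      by (simp add: X_def g_def open_vertices_def)
    fix k x assume xk: "x k \<in> open_vertices V E" and "0 < \<P>(w in M. \<forall>i\<le>k. X i w = x i)"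
    then have p: "P.prob {w. \<forall>i\<le>k. X i w = x i} > 0" by (simp add: spM)
    note n = parent_in[OF FT rV O[OF xk]] child_neq[OF FT rV O[OF xk] thc[OF xk], of k]
    show "\<P>(w in M. X (Suc k) w = x k \<bar> \<forall>i\<le>k. X i w = x i) = 1 - \<epsilon>"
      by (subst cond[OF p, of "x k" "{0}"]) (use n xk q0 in \<open>auto simp: g_def\<close>)
    show "\<P>(w in M. X (Suc k) w = parent V E r (x k) \<bar> \<forall>i\<le>k. X i w = x i) = \<epsilon> * (l / (1 + l))"
      by (subst cond[OF p, of "parent V E r (x k)" "{1}"]) (use n xk q1 in \<open>auto simp: g_def\<close>)
    show "\<P>(w in M. X (Suc k) w = \<theta> l (x k) k \<bar> \<forall>i\<le>k. X i w = x i) = \<epsilon> * (1 / (1 + l))"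
      by (subst cond[OF p, of "\<theta> l (x k) k" "{2..}"]) (use n xk q2 in \<open>auto simp: g_def\<close>)
  qed
  then show ?thesis by blast
qed

end

theory Submission
  imports Defs
begin

text \<open>The proof has an analytic half and a probabilistic half, joined by one linear equation.

  In the analytic half the value function is found explicitly. The larger of the extreme values
  around an open vertex is always attained at the parent and the smaller one at a child that is
  closest to the non-root leaves, so the value at \<open>v\<close> is a multiple \<open>ratio l (d_out v)\<close> of the value
  at its parent, where \<open>ratio\<close> solves the recursion that the harmonic equation imposes
  (\<open>val_harmonic\<close>). A maximum principle shows that there is no other solution
  (\<open>harmonic_unique\<close>). Since the vertices that attain the extreme values do not depend on \<open>l\<close>, the
  equation
  \<open>h v = l / (l + 1) * h (parent v) + 1 / (l + 1) * h c\<close>, for every \<open>c \<in> V_minus v\<close>, can be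
  differentiated in \<open>l\<close>. The derivative of the weights contributes \<open>\<Delta> v / (l + 1)\<^sup>2\<close>, so that
  \<open>G = (l + 1)\<^sup>2 * \<partial>h/\<partial>l\<close> satisfies
  \<open>G v = \<Delta> v + l / (l + 1) * G (parent v) + 1 / (l + 1) * G c\<close> on the open vertices and vanishes on
  the leaves (\<open>gain_mean\<close>, \<open>gain_leaf\<close>).

  In the probabilistic half this equation says that, whichever \<open>\<theta>\<close> picks the child, the mean of
  \<open>G\<close> drops in each step by \<open>\<epsilon>\<close> times the mean of \<open>\<Delta>\<close> over the runs that have not yet stopped
  (\<open>expected_step\<close>). Summing over time, \<open>\<epsilon>\<close> times the mean total variation up to time \<open>n\<close> is
  \<open>G v\<close> minus the mean of \<open>G\<close> at time \<open>n\<close>. As \<open>G\<close> is nonnegative, the mean total variation is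
  finite; as \<open>\<Delta>\<close> is positive on the finitely many open vertices, \<open>G\<close> is at most a constant times
  \<open>\<Delta>\<close> there, and hence the mean of \<open>G\<close> at time \<open>n\<close> is dominated by the terms of a convergent
  series and tends to zero (\<open>mean_TotVar_eq_gain\<close>).\<close>

section \<open>Structure of a rooted tree\<close>

locale reward_tree =
  fixes V :: "'v set" and E :: "'v set set" and r :: 'v
  assumes tree: "root_reward_tree V E r"
begin

abbreviation "par \<equiv> parent V E r"
abbreviation "kids \<equiv> children V E r"
abbreviation "opens \<equiv> open_vertices V E"
abbreviation "ends \<equiv> leaves V E - {r}"
abbreviation "dist_out \<equiv> d_out V E r"

lemma finite_tree: "finite_tree V E"
  and finite_V: "finite V"
  and root_leaf: "r \<in> leaves V E"
  and root_in: "r \<in> V"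
  using tree by (auto simp: root_reward_tree_def finite_tree_def leaves_def)

lemma edgeD:
  assumes "{a, b} \<in> E"
  shows "a \<in> V" "b \<in> V" "a \<noteq> b"
proof -
  from assms finite_tree obtain c d where "c \<in> V" "d \<in> V" "c \<noteq> d" "{a, b} = {c, d}"
    unfolding finite_tree_def by metis
  then show "a \<in> V" "b \<in> V" "a \<noteq> b" by (auto simp: doubleton_eq_iff)
qed

lemma path_unique:
  assumes "is_path V E xs" "is_path V E ys" "hd xs = hd ys" "last xs = last ys"
  shows "xs = ys"
proof -
  have "hd xs \<in> V" "last xs \<in> V"
    using assms(1) by (auto simp: is_path_def)
  with finite_tree have "\<exists>!zs. is_path V E zs \<and> hd zs = hd xs \<and> last zs = last xs"
    by (simp add: finite_tree_def)
  with assms show ?thesis by metis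
qed

text \<open>The path from a vertex to the root. Its length serves as a measure for inductions along the
  tree, and the value function is a product over it.\<close>

definition up :: "'v \<Rightarrow> 'v list" where
  "up v = (THE xs. is_path V E xs \<and> hd xs = v \<and> last xs = r)"

lemma up_eqI:
  assumes "is_path V E xs" "hd xs = v" "last xs = r"
  shows "up v = xs"
  unfolding up_def using assms path_unique by (intro the_equality) auto

lemma up_root: "up r = [r]"
  by (rule up_eqI) (auto simp: is_path_def root_in)

lemma up_path:
  assumes "v \<in> V"
  shows "is_path V E (up v)" "hd (up v) = v" "last (up v) = r"
proof -
  obtain xs where "is_path V E xs" "hd xs = v" "last xs = r"
    using finite_tree root_in assms unfolding finite_tree_def by metis
  with up_eqI show "is_path V E (up v)" "hd (up v) = v" "last (up v) = r" by auto
qed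

lemma par_in: "v \<in> V \<Longrightarrow> v \<noteq> r \<Longrightarrow> par v \<in> V"
  by (rule parent_in[OF finite_tree root_in])

lemma up_step:
  assumes "v \<in> V" "v \<noteq> r"
  shows "up v = v # up (par v)" "{par v, v} \<in> E"
proof -
  obtain xs where xs: "is_path V E (v # par v # xs)" "last (v # par v # xs) = r"
    using parent_path[OF finite_tree root_in assms] by blast
  then have "up v = v # par v # xs" "up (par v) = par v # xs"
    by (auto intro!: up_eqI simp: is_path_def)
  then show "up v = v # up (par v)" by simp
  show "{par v, v} \<in> E" using xs by (simp add: is_path_def insert_commute)
qed

lemma up_kid: "c \<in> kids v \<Longrightarrow> up c = c # up v"
  using up_step(1)[of c] by (auto simp: children_def)

text \<open>The distance to the root drops by one along every edge to a parent.\<close>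

lemma root_induct [consumes 1, case_names root step]:
  assumes "v \<in> V" and "P r"
    and "\<And>v. v \<in> V \<Longrightarrow> v \<noteq> r \<Longrightarrow> P (par v) \<Longrightarrow> P v"
  shows "P v"
  using assms(1)
proof (induction "length (up v)" arbitrary: v rule: less_induct)
  case less
  show ?case
  proof (cases "v = r")
    case False
    then have "length (up (par v)) < length (up v)" using up_step(1) less.prems by simp
    then show ?thesis using less False par_in assms(3) by blast
  qed (simp add: assms(2))
qed

text \<open>A neighbour \<open>u\<close> of \<open>v\<close> that is not on the path from \<open>v\<close> to the root can be put in front of
  that path, so \<open>v\<close> is its parent; a neighbour on the path is its second vertex, since otherwise
  the edge and the path would be two ways from \<open>v\<close> to \<open>u\<close>.\<close>

lemma nbr_cases:
  assumes "v \<in> V" and "u \<in> nbrs E v"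
  shows "u \<in> kids v \<or> v \<noteq> r \<and> u = par v"
proof (cases "u \<in> set (up v)")
  case False
  have e: "{u, v} \<in> E" using assms by (simp add: nbrs_def)
  obtain xs where xs: "up v = v # xs"
    using up_path[OF \<open>v \<in> V\<close>] by (cases "up v") (auto simp: is_path_def)
  have "is_path V E (u # v # xs)" "last (u # v # xs) = r"
    using up_path[OF \<open>v \<in> V\<close>] False e edgeD[OF e] unfolding xs by (auto simp: is_path_def)
  moreover from this have "u \<noteq> r" using False up_path[OF \<open>v \<in> V\<close>] unfolding xs
    by (metis last_in_set list.distinct(1))
  ultimately show ?thesis
    using parent_eqI[OF finite_tree root_in] edgeD[OF e] by (auto simp: children_def)
next
  case True
  have e: "{v, u} \<in> E" using assms by (simp add: nbrs_def insert_commute)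
  from True obtain ps bs where s: "up v = ps @ u # bs" by (meson split_list)
  have "hd (ps @ [u]) = v" using up_path(2)[OF \<open>v \<in> V\<close>] s by (cases ps) auto
  moreover have "is_path V E (ps @ [u])"
    using up_path(1)[OF \<open>v \<in> V\<close>] unfolding s
    by (cases ps rule: rev_cases) (auto simp: is_path_def successively_append_iff)
  moreover have "is_path V E [v, u]" using e edgeD[OF e] by (simp add: is_path_def)
  ultimately have "ps @ [u] = [v, u]" by (intro path_unique) auto
  then have "up v = v # u # bs" using s by simp
  then show ?thesis
    using parent_eqI[OF finite_tree root_in, of v u bs] up_path[OF \<open>v \<in> V\<close>]
    by (auto simp: up_root)
qed

lemma kids_nbrs: "kids v \<subseteq> nbrs E v"
  using up_step(2) by (auto simp: children_def nbrs_def insert_commute)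

lemma finite_nbrs: "finite (nbrs E v)"
  by (rule finite_subset[OF _ finite_V]) (auto simp: nbrs_def dest: edgeD)

lemma openD:
  assumes "v \<in> opens"
  shows "v \<in> V" "v \<noteq> r" "par v \<in> V"
  using assms root_leaf par_in by (auto simp: open_vertices_def)

lemma kidD: "c \<in> kids v \<Longrightarrow> c \<in> V" "c \<in> kids v \<Longrightarrow> par c = v" "c \<in> kids v \<Longrightarrow> c \<noteq> r"
  by (auto simp: children_def)

lemma par_not_kid: "v \<in> V \<Longrightarrow> v \<noteq> r \<Longrightarrow> par v \<notin> kids v"
  using child_neq(3)[OF finite_tree root_in] by blast

lemma nbrs_nonroot: "v \<in> V \<Longrightarrow> v \<noteq> r \<Longrightarrow> nbrs E v = insert (par v) (kids v)"
  using nbr_cases kids_nbrs up_step(2) by (fastforce simp: nbrs_def)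

lemma finite_kids: "finite (kids v)"
  by (rule finite_subset[OF kids_nbrs finite_nbrs])

text \<open>Away from the root the parent is one of the neighbours, so having a single neighbour means
  having no child.\<close>

lemma kids_empty_iff: 
  assumes "v \<in> V" "v \<noteq> r"
  shows "kids v = {} \<longleftrightarrow> v \<in> ends"
  using assms nbrs_nonroot[OF assms] par_not_kid[OF assms] finite_kids[of v]
  by (simp add: leaves_def)

lemma par_not_end:
  assumes "v \<in> V" "v \<noteq> r"
  shows "par v \<notin> ends"
  using assms kids_empty_iff[of "par v"] by (auto simp: children_def leaves_def)

lemma V_cases: "v \<in> V \<Longrightarrow> v = r \<or> v \<in> ends \<or> v \<in> opens"
  by (auto simp: open_vertices_def)


section \<open>The distance to the leaves below a vertex\<close>

text \<open>A list in which each vertex is followed by one of its children is automatically a path,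
  because distances to the root increase along it.\<close>

lemma descending_path:
  assumes "successively (\<lambda>a b. b \<in> kids a) xs" "xs \<noteq> []" "hd xs \<in> V"
  shows "is_path V E xs \<and> (\<forall>x\<in>set xs. length (up (hd xs)) \<le> length (up x))"
  using assms
proof (induction xs rule: induct_list012)
  case (3 x y zs)
  then have y: "y \<in> kids x" by simp
  with 3 kidD have IH: "is_path V E (y # zs)"
      "\<And>z. z \<in> set (y # zs) \<Longrightarrow> length (up y) \<le> length (up z)" by auto
  have "length (up y) = Suc (length (up x))" using up_kid[OF y] by simp
  moreover from this IH(2) have "x \<notin> set (y # zs)" by (metis Suc_n_not_le_n)
  moreover have "{x, y} \<in> E" using kids_nbrs y by (auto simp: nbrs_def insert_commute)
  ultimately show ?case using 3 IH by (fastforce simp: is_path_def)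
qed (auto simp: is_path_def)

text \<open>The condition in \<open>d_out\<close> without the requirement that the list is a path, so that it obeys a
  plain recursion over children.\<close>

definition descent :: "'v \<Rightarrow> nat \<Rightarrow> bool" where
  "descent v n \<longleftrightarrow> (\<exists>xs. length xs = Suc n \<and> successively (\<lambda>a b. b \<in> kids a) xs \<and>
     hd xs = v \<and> last xs \<in> ends)"

lemma dist_out_Least:
  assumes "v \<in> V"
  shows "dist_out v = (LEAST n. descent v n)"
proof -
  have "(\<exists>xs. length xs = Suc n \<and> is_path V E xs \<and> successively (\<lambda>a b. b \<in> kids a) xs \<and>
      hd xs = v \<and> last xs \<in> ends) \<longleftrightarrow> descent v n" for n
    unfolding descent_def using descending_path assms
    by (metis length_0_conv nat.distinct(1))
  then show ?thesis unfolding d_out_def by presburger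
qed

lemma descent_0: "descent v 0 \<longleftrightarrow> v \<in> ends"
  unfolding descent_def by (auto simp: length_Suc_conv intro!: exI[of _ "[v]"])

lemma descent_Suc: "descent v (Suc n) \<longleftrightarrow> (\<exists>c\<in>kids v. descent c n)"
proof
  assume "descent v (Suc n)"
  then obtain xs where xs: "length xs = Suc (Suc n)" "successively (\<lambda>a b. b \<in> kids a) xs"
    "hd xs = v" "last xs \<in> ends" unfolding descent_def by blast
  then obtain c ys where "xs = v # c # ys" by (auto simp: length_Suc_conv)
  with xs show "\<exists>c\<in>kids v. descent c n"
    unfolding descent_def by (intro bexI[of _ c] exI[of _ "c # ys"]) auto
next
  assume "\<exists>c\<in>kids v. descent c n"
  then obtain c xs where c: "c \<in> kids v" and xs: "length xs = Suc n"
    "successively (\<lambda>a b. b \<in> kids a) xs" "hd xs = c" "last xs \<in> ends"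
    unfolding descent_def by blast
  then show "descent v (Suc n)"
    unfolding descent_def by (intro exI[of _ "v # xs"]) (cases xs; auto)
qed

text \<open>Going down from child to child must end, since paths to the root have at most \<open>card V\<close>
  vertices.\<close>

lemma descent_exists:
  assumes "v \<in> V" "v \<noteq> r"
  shows "\<exists>n. descent v n"
  using assms
proof (induction "card V - length (up v)" arbitrary: v rule: less_induct)
  case less
  show ?case
  proof (cases "kids v = {}")
    case True
    then show ?thesis using kids_empty_iff less.prems descent_0 by blast
  next
    case False
    then obtain c where c: "c \<in> kids v" by blast
    have "length (up c) \<le> card V"
      using up_path(1)[OF kidD(1)[OF c]] finite_V
      by (metis card_mono distinct_card is_path_def)
    then have "card V - length (up c) < card V - length (up v)" using up_kid[OF c] by simp
    with less(1) c kidD descent_Suc show ?thesis by blast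
  qed
qed

lemma dist_out_end: "v \<in> ends \<Longrightarrow> dist_out v = 0"
  using dist_out_Least[of v] descent_0 by (simp add: leaves_def)

lemma dist_out_open_pos:
  assumes "v \<in> opens"
  shows "dist_out v > 0"
proof -
  have "descent v (dist_out v)"
    using dist_out_Least descent_exists openD[OF assms] by (metis LeastI_ex)
  moreover have "\<not> descent v 0" using assms by (auto simp: descent_0 open_vertices_def)
  ultimately show ?thesis by (metis gr0I)
qed

lemma dist_out_le_kid:
  assumes "v \<in> V" "c \<in> kids v"
  shows "dist_out v \<le> Suc (dist_out c)"
proof -
  have "descent c (dist_out c)"
    using dist_out_Least descent_exists kidD assms by (metis LeastI_ex)
  then have "descent v (Suc (dist_out c))" using descent_Suc assms by blast
  then show ?thesis using dist_out_Least[OF assms(1)] by (simp add: Least_le)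
qed

lemma V_minus_nonempty:
  assumes "v \<in> opens"
  shows "V_minus V E r v \<noteq> {}"
proof -
  obtain m where m: "dist_out v = Suc m" using dist_out_open_pos[OF assms] gr0_conv_Suc by blast
  have "descent v (dist_out v)"
    using dist_out_Least descent_exists openD[OF assms] by (metis LeastI_ex)
  then obtain c where c: "c \<in> kids v" "descent c m" using m descent_Suc by auto
  then have "dist_out c \<le> m" using dist_out_Least kidD by (simp add: Least_le)
  then have "dist_out c = m" using dist_out_le_kid[OF openD(1)[OF assms] c(1)] m by simp
  then show ?thesis using c m by (auto simp: V_minus_def)
qed

lemma V_minusD:
  assumes "c \<in> V_minus V E r v"
  shows "c \<in> kids v" "dist_out v = Suc (dist_out c)"
  using assms by (auto simp: V_minus_def)

end


section \<open>The explicit value function\<close>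

text \<open>If \<open>c \<in> V_minus v\<close> has value \<open>a * h v\<close>, then
  \<open>h v = l / (l + 1) * h (parent v) + 1 / (l + 1) * a * h v\<close> gives
  \<open>h v = l / (1 + l - a) * h (parent v)\<close>. Leaves other than the root have value \<open>0\<close>, so \<open>ratio l d\<close>
  is the value of a vertex at outward distance \<open>d\<close> relative to that of its parent. In closed form
  it is \<open>(l + \<dots> + l ^ d) / (1 + l + \<dots> + l ^ d)\<close>.\<close>

primrec ratio :: "real \<Rightarrow> nat \<Rightarrow> real" where
  "ratio l 0 = 0"
| "ratio l (Suc d) = l / (1 + l - ratio l d)"

lemma ratio_bounds:
  assumes "0 < l"
  shows "0 \<le> ratio l d \<and> ratio l d < 1"
  by (induction d) (use assms in \<open>auto simp: field_simps\<close>)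

text \<open>This monotonicity is why the smallest value around a vertex sits at a child of least outward
  distance.\<close>

lemma ratio_strict_mono:
  assumes "0 < l"
  shows "strict_mono (ratio l)"
proof (rule strict_monoI_Suc)
  fix d show "ratio l d < ratio l (Suc d)"
  proof (induction d)
    case (Suc d)
    moreover have "0 < 1 + l - ratio l d" "0 < 1 + l - ratio l (Suc d)"
      using assms ratio_bounds[OF assms, of d] ratio_bounds[OF assms, of "Suc d"] by linarith+
    ultimately have "l / (1 + l - ratio l d) < l / (1 + l - ratio l (Suc d))"
      using assms by (intro divide_strict_left_mono mult_pos_pos) linarith+
    then show ?case by simp
  qed (use assms in auto)
qed

lemma ratio_pos: "0 < l \<Longrightarrow> 0 < d \<Longrightarrow> 0 < ratio l d"
  using strict_monoD[OF ratio_strict_mono, of l 0 d] by simp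

lemma ratio_differentiable:
  assumes "0 < l"
  shows "(\<lambda>l. ratio l d) field_differentiable (at l)"
proof (induction d)
  case (Suc d)
  have "1 + l - ratio l d \<noteq> 0" using ratio_bounds[OF assms, of d] assms by simp
  then show ?case
    by (auto intro!: field_differentiable_divide field_differentiable_diff
        field_differentiable_add Suc derivative_intros)
qed simp

context reward_tree
begin

text \<open>Every vertex on the way up to the root contributes its ratio; the root, last on its path,
  contributes nothing and has value \<open>1\<close>.\<close>

definition val :: "real \<Rightarrow> 'v \<Rightarrow> real" where
  "val l v = (\<Prod>u\<leftarrow>butlast (up v). ratio l (dist_out u))"

lemma val_root: "val l r = 1"
  by (simp add: val_def up_root)

lemma val_step:
  assumes "v \<in> V" "v \<noteq> r"
  shows "val l v = ratio l (dist_out v) * val l (par v)"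
proof -
  have "up (par v) \<noteq> []" using up_path(1)[OF par_in[OF assms]] by (simp add: is_path_def)
  then show ?thesis by (simp add: val_def up_step(1)[OF assms])
qed

lemma val_end: "v \<in> ends \<Longrightarrow> val l v = 0"
  using val_step[of v l] dist_out_end by (simp add: leaves_def)

lemma val_kid: "c \<in> kids v \<Longrightarrow> val l c = ratio l (dist_out c) * val l v"
  using val_step[of c l] kidD by auto

lemma val_nonneg:
  assumes "0 < l" "v \<in> V"
  shows "0 \<le> val l v"
  using assms(2) by (induction rule: root_induct) (use ratio_bounds[OF \<open>0 < l\<close>] val_step val_root in auto)

lemma val_pos:
  assumes "0 < l" "v \<in> V" "v \<notin> ends"
  shows "0 < val l v"
  using assms(2,3)
proof (induction rule: root_induct)
  case (step v)
  then have "v \<in> opens" by (simp add: open_vertices_def)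
  then show ?case using step par_not_end val_step ratio_pos[OF assms(1)] dist_out_open_pos by simp
qed (simp add: val_root)

lemma val_less_par:
  assumes "0 < l" "v \<in> V" "v \<noteq> r"
  shows "val l v < val l (par v)"
  using val_step[OF assms(2,3), of l] val_pos[OF assms(1) par_in par_not_end, OF assms(2,3) assms(2,3)]
    ratio_bounds[OF assms(1), of "dist_out v"] by simp

text \<open>The parent is the only neighbour with the largest value. The strictness is what lets the
  maximum principle below move an extremum to the parent.\<close>

lemma val_less_par_nbr:
  assumes "0 < l" "v \<in> opens" "u \<in> nbrs E v" "u \<noteq> par v"
  shows "val l u < val l (par v)"
proof -
  have "u \<in> kids v" using assms nbrs_nonroot openD by auto
  then have "val l u < val l v" using val_less_par[OF assms(1), of u] kidD by auto
  also have "val l v < val l (par v)" using val_less_par[OF assms(1)] openD[OF assms(2)] by simp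
  finally show ?thesis .
qed

lemma Max_val_nbrs:
  assumes "0 < l" "v \<in> opens"
  shows "Max (val l ` nbrs E v) = val l (par v)"
proof (rule Max_eqI)
  show "y \<le> val l (par v)" if "y \<in> val l ` nbrs E v" for y
    using that val_less_par_nbr[OF assms] by fastforce
qed (use finite_nbrs finite_kids nbrs_nonroot openD[OF assms(2)] in auto)

lemma Min_val_nbrs:
  assumes "0 < l" "v \<in> opens" "c \<in> V_minus V E r v"
  shows "Min (val l ` nbrs E v) = val l c"
proof (rule Min_eqI)
  note c = V_minusD[OF assms(3)]
  note v = openD[OF assms(2)]
  show "val l c \<in> val l ` nbrs E v" using c kids_nbrs by blast
  have kid: "val l c \<le> val l u" if "u \<in> kids v" for u
  proof -
    have "dist_out c \<le> dist_out u" using dist_out_le_kid[OF v(1) that] c by simp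
    then have "ratio l (dist_out c) \<le> ratio l (dist_out u)"
      using ratio_strict_mono[OF assms(1)] by (simp add: strict_mono_less_eq)
    then show ?thesis using val_kid c that val_nonneg[OF assms(1) v(1)] by (simp add: mult_right_mono)
  qed
  show "val l c \<le> y" if "y \<in> val l ` nbrs E v" for y
    using that kid val_less_par_nbr[OF assms(1,2), of c] kids_nbrs c
      par_not_kid[OF v(1,2)] nbrs_nonroot[OF v(1,2)] by (fastforce simp: less_imp_le)
qed (simp add: finite_nbrs)

lemma val_mean:
  assumes "0 < l" "v \<in> opens" "c \<in> V_minus V E r v"
  shows "val l v = l / (l + 1) * val l (par v) + 1 / (l + 1) * val l c"
proof -
  note c = V_minusD[OF assms(3)]
  define a where "a = ratio l (dist_out c)"
  have a: "1 + l - a > 0" using ratio_bounds[OF assms(1), of "dist_out c"] assms(1) by (simp add: a_def)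
  have "val l v = l / (1 + l - a) * val l (par v)" "val l c = a * val l v"
    using val_step openD[OF assms(2)] val_kid c by (simp_all add: a_def)
  then have "val l v * (1 + l - a) = l * val l (par v)" "val l c = a * val l v"
    using a by (simp_all add: field_simps)
  then have "(l + 1) * val l v = l * val l (par v) + val l c" by (simp add: algebra_simps)
  then have "val l v = (l * val l (par v) + val l c) / (l + 1)"
    using assms(1) by (simp add: eq_divide_eq mult.commute)
  then show ?thesis by (simp add: add_divide_distrib)
qed

lemma val_harmonic:
  assumes "0 < l"
  shows "biased_infinity_harmonic V E r l (val l)"
  unfolding biased_infinity_harmonic_def
proof (intro conjI ballI)
  show "val l v = reward r v" if "v \<in> leaves V E" for v
    using that val_root val_end by (simp add: reward_def)
  show "val l v = l / (l + 1) * Max (val l ` nbrs E v) + 1 / (l + 1) * Min (val l ` nbrs E v)"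
    if v: "v \<in> opens" for v
  proof -
    obtain c where c: "c \<in> V_minus V E r v" using V_minus_nonempty[OF v] by blast
    show ?thesis using val_mean Max_val_nbrs Min_val_nbrs assms v c by metis
  qed
qed


section \<open>Uniqueness of the value function\<close>

text \<open>If \<open>f - g\<close> is maximal at \<open>v\<close>, then both the difference of the neighbouring maxima and that of
  the neighbouring minima are at most \<open>f v - g v\<close>; as their average with positive
  weights is \<open>f v - g v\<close>, they are equal to it. So a neighbour that is largest for \<open>f\<close> is also largest for \<open>g\<close> and again a
  maximum point of \<open>f - g\<close>.\<close>

lemma max_nbr_propagates:
  assumes "0 < l"
    and f: "biased_infinity_harmonic V E r l f" and g: "biased_infinity_harmonic V E r l g"
    and M: "\<And>w. w \<in> V \<Longrightarrow> f w - g w \<le> M"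
    and v: "v \<in> opens" "f v - g v = M"
    and u: "u \<in> nbrs E v" "f u = Max (f ` nbrs E v)"
  shows "f u - g u = M \<and> g u = Max (g ` nbrs E v)"
proof -
  let ?N = "nbrs E v"
  have NV: "?N \<subseteq> V" by (auto simp: nbrs_def dest: edgeD)
  have "Min (g ` ?N) \<in> g ` ?N" using finite_nbrs u(1) by (intro Min_in) auto
  then obtain w where w: "w \<in> ?N" "g w = Min (g ` ?N)" by fastforce
  have gu: "g u \<le> Max (g ` ?N)" using finite_nbrs u by simp
  have fw: "Min (f ` ?N) \<le> f w" using finite_nbrs w by simp
  have up: "Max (f ` ?N) - Max (g ` ?N) \<le> M" using M[of u] u NV gu by auto
  have lo: "Min (f ` ?N) - Min (g ` ?N) \<le> M" using M[of w] w NV fw by auto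
  have "(l + 1) * k v = l * Max (k ` ?N) + Min (k ` ?N)" if "biased_infinity_harmonic V E r l k" for k
  proof -
    have "k v = (l * Max (k ` ?N) + Min (k ` ?N)) / (l + 1)"
      using that v(1) unfolding biased_infinity_harmonic_def by (simp add: add_divide_distrib)
    then show ?thesis using assms(1) by (simp add: eq_divide_eq mult.commute)
  qed
  from this[OF f] this[OF g] v(2)
  have "(l + 1) * M = l * (Max (f ` ?N) - Max (g ` ?N)) + (Min (f ` ?N) - Min (g ` ?N))"
    by (auto simp: algebra_simps)
  then have "l * M \<le> l * (Max (f ` ?N) - Max (g ` ?N))" using lo by (simp add: algebra_simps)
  then have "M \<le> Max (f ` ?N) - Max (g ` ?N)" using assms(1) by simp
  with up gu u(2) M[of u] u(1) NV show ?thesis by fastforce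
qed

text \<open>A maximum point of \<open>f - g\<close> can be moved from parent to parent until it reaches a leaf, at the
  latest the root, and there \<open>f\<close> and \<open>g\<close> agree.\<close>

lemma comparison:
  assumes f: "biased_infinity_harmonic V E r l f" and g: "biased_infinity_harmonic V E r l g"
    and par: "\<And>M v. (\<And>w. w \<in> V \<Longrightarrow> f w - g w \<le> M) \<Longrightarrow> v \<in> opens \<Longrightarrow> f v - g v = M \<Longrightarrow>
      f (par v) - g (par v) = M"
    and "v \<in> V"
  shows "f v \<le> g v"
proof -
  define M where "M = Max ((\<lambda>w. f w - g w) ` V)"
  have M: "f w - g w \<le> M" if "w \<in> V" for w using that finite_V by (simp add: M_def)
  obtain w where w: "w \<in> V" "f w - g w = M"
    using Max_in[of "(\<lambda>w. f w - g w) ` V"] finite_V root_in unfolding M_def by fastforce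
  have leaf: "f x - g x = 0" if "x \<in> leaves V E" for x
    using f g that by (simp add: biased_infinity_harmonic_def)
  have "f w - g w = M \<longrightarrow> M = 0" using w(1)
  proof (induction rule: root_induct)
    case root then show ?case using leaf[OF root_leaf] by simp
  next
    case (step w) then show ?case using V_cases[of w] leaf[of w] par[OF M] by auto
  qed
  with w M[OF \<open>v \<in> V\<close>] show ?thesis by simp
qed

text \<open>Two comparisons with \<open>val\<close>. In one of them the extremum moves to a neighbour that is largest
  for \<open>val\<close>, which can be taken to be the parent; in the other it moves to one that is largest for
  \<open>f\<close>, which is then also largest for \<open>val\<close> and therefore is the parent.\<close>

lemma harmonic_unique:
  assumes l: "0 < l" and f: "biased_infinity_harmonic V E r l f" and "v \<in> V"
  shows "f v = val l v"
proof (rule antisym)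
  note g = val_harmonic[OF l]
  have parN: "par v \<in> nbrs E v" if "v \<in> opens" for v using nbrs_nonroot openD that by simp
  show "f v \<le> val l v"
  proof (rule comparison[OF f g _ \<open>v \<in> V\<close>])
    fix M v assume M: "\<And>w. w \<in> V \<Longrightarrow> f w - val l w \<le> M" and v: "v \<in> opens" "f v - val l v = M"
    obtain u where u: "u \<in> nbrs E v" "f u = Max (f ` nbrs E v)"
      using Max_in[of "f ` nbrs E v"] finite_nbrs[of v] parN[OF v(1)] by fastforce
    from max_nbr_propagates[OF l f g M v u] Max_val_nbrs[OF l v(1)] val_less_par_nbr[OF l v(1) u(1)]
    show "f (par v) - val l (par v) = M" by fastforce
  qed
  show "val l v \<le> f v"
  proof (rule comparison[OF g f _ \<open>v \<in> V\<close>])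
    fix M v assume M: "\<And>w. w \<in> V \<Longrightarrow> val l w - f w \<le> M" and v: "v \<in> opens" "val l v - f v = M"
    from max_nbr_propagates[OF l g f M v parN[OF v(1)]] Max_val_nbrs[OF l v(1)]
    show "val l (par v) - f (par v) = M" by simp
  qed
qed

text \<open>The set \<open>V\<close> contains the neighbours of each of its vertices, so restricting \<open>val\<close> to \<open>V\<close> does
  not affect harmonicity.\<close>

lemma h_eq_val:
  assumes "0 < l" "v \<in> V"
  shows "h V E r l v = val l v"
proof -
  have nbrV: "nbrs E v \<subseteq> V" for v by (auto simp: nbrs_def dest: edgeD)
  have "h V E r l = restrict (val l) V"
    unfolding h_def
  proof (rule the_equality, intro conjI)
    show "restrict (val l) V \<in> V \<rightarrow>\<^sub>E {0..}" using val_nonneg[OF assms(1)] by auto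
    have "restrict (val l) V ` nbrs E v = val l ` nbrs E v" for v
      using nbrV by (intro image_cong) auto
    then show "biased_infinity_harmonic V E r l (restrict (val l) V)"
      using val_harmonic[OF assms(1)] 
      by (auto simp: biased_infinity_harmonic_def leaves_def open_vertices_def)
  next
    fix f assume "f \<in> V \<rightarrow>\<^sub>E {0..} \<and> biased_infinity_harmonic V E r l f"
    then show "f = restrict (val l) V"
      using harmonic_unique[OF assms(1)] by (intro PiE_ext[of _ V "\<lambda>_. UNIV"]) auto
  qed
  then show ?thesis using assms by simp
qed

lemma Delta_eq:
  assumes "0 < l" "v \<in> opens" "c \<in> V_minus V E r v"
  shows "Delta V E r l v = val l (par v) - val l c"
proof -
  have "h V E r l ` nbrs E v = val l ` nbrs E v"
    using h_eq_val[OF assms(1)] by (intro image_cong) (auto simp: nbrs_def dest: edgeD)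
  then show ?thesis using Max_val_nbrs Min_val_nbrs assms by (simp add: Delta_def)
qed

lemma Delta_pos:
  assumes "0 < l" "v \<in> opens"
  shows "Delta V E r l v > 0"
proof -
  obtain c where c: "c \<in> V_minus V E r v" using V_minus_nonempty[OF assms(2)] by blast
  then have "val l c < val l (par v)"
    using val_less_par_nbr[OF assms] V_minusD kids_nbrs par_not_kid openD[OF assms(2)]
    by (metis subsetD)
  then show ?thesis using Delta_eq assms c by simp
qed


section \<open>The derivative in the bias\<close>

definition gain :: "real \<Rightarrow> 'v \<Rightarrow> real" where
  "gain l v = (l + 1)\<^sup>2 * deriv (\<lambda>l. h V E r l v) l"

lemma val_differentiable:
  assumes "0 < l" "v \<in> V"
  shows "(\<lambda>l. val l v) field_differentiable (at l)"
  using assms(2)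
proof (induction rule: root_induct)
  case (step v)
  then have "(\<lambda>l. val l v) = (\<lambda>l. ratio l (dist_out v) * val l (par v))"
    using val_step by blast
  then show ?case
    using step ratio_differentiable[OF assms(1)] by (auto intro!: field_differentiable_mult)
qed (simp add: val_root)

lemma gain_eq:
  assumes "0 < l" "v \<in> V"
  shows "gain l v = (l + 1)\<^sup>2 * deriv (\<lambda>l. val l v) l"
proof -
  have "eventually (\<lambda>x. h V E r x v = val x v) (nhds l)"
    using h_eq_val assms by (intro eventually_mono[OF eventually_nhds_in_open[of "{0<..}"]]) auto
  then show ?thesis unfolding gain_def using deriv_cong_ev by metis
qed

lemma gain_leaf:
  assumes "0 < l" "v \<in> leaves V E"
  shows "gain l v = 0"
proof -
  have "v \<in> V" using assms by (simp add: leaves_def)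
  have "(\<lambda>l. val l v) = (\<lambda>l. if v = r then 1 else 0)"
    using val_root val_end assms by auto
  then show ?thesis using gain_eq[OF assms(1) \<open>v \<in> V\<close>] by simp
qed

text \<open>The mean value equation of \<open>val\<close> holds with the same \<open>c\<close> for all biases and can be
  differentiated. The weights \<open>l / (l + 1)\<close> and \<open>1 / (l + 1)\<close> have derivatives \<open>1 / (l + 1)\<^sup>2\<close> and
  \<open>- 1 / (l + 1)\<^sup>2\<close>, which produce the term \<open>Delta\<close>.\<close>

lemma gain_mean:
  assumes l: "0 < l" and v: "v \<in> opens" and c: "c \<in> V_minus V E r v"
  shows "gain l v = Delta V E r l v + l / (l + 1) * gain l (par v) + 1 / (l + 1) * gain l c"
proof -
  let ?d = "\<lambda>u. deriv (\<lambda>l. val l u) l"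
  have cV: "c \<in> V" using V_minusD(1)[OF c] kidD by blast
  have D: "((\<lambda>l. val l u) has_field_derivative ?d u) (at l)" if "u \<in> V" for u
    using val_differentiable[OF l that] field_differentiable_derivI by blast
  have weights: "((\<lambda>x. x / (x + 1)) has_field_derivative 1 / (l + 1)\<^sup>2) (at l)"
    "((\<lambda>x. 1 / (x + 1)) has_field_derivative - 1 / (l + 1)\<^sup>2) (at l)"
    using l by (auto intro!: derivative_eq_intros simp: power2_eq_square)
  have "((\<lambda>x. x / (x + 1) * val x (par v) + 1 / (x + 1) * val x c) has_field_derivative
     (l / (l + 1) * ?d (par v) + 1 / (l + 1)\<^sup>2 * val l (par v)) +
     (1 / (l + 1) * ?d c + - 1 / (l + 1)\<^sup>2 * val l c)) (at l)"
    by (intro DERIV_add DERIV_mult' weights D openD(3)[OF v] cV)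
  then have "deriv (\<lambda>x. x / (x + 1) * val x (par v) + 1 / (x + 1) * val x c) l =
     (l / (l + 1) * ?d (par v) + 1 / (l + 1)\<^sup>2 * val l (par v)) +
     (1 / (l + 1) * ?d c + - 1 / (l + 1)\<^sup>2 * val l c)"
    by (rule DERIV_imp_deriv)
  moreover have "eventually (\<lambda>x. val x v = x / (x + 1) * val x (par v) + 1 / (x + 1) * val x c) (nhds l)"
    using val_mean[OF _ v c] l by (intro eventually_mono[OF eventually_nhds_in_open[of "{0<..}"]]) auto
  then have "?d v = deriv (\<lambda>x. x / (x + 1) * val x (par v) + 1 / (x + 1) * val x c) l"
    by (rule deriv_cong_ev) simp
  ultimately have dv: "?d v = (l / (l + 1) * ?d (par v) + 1 / (l + 1)\<^sup>2 * val l (par v)) +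
     (1 / (l + 1) * ?d c + - 1 / (l + 1)\<^sup>2 * val l c)"
    by simp
  have clear: "s\<^sup>2 * ((l / s * a + 1 / s\<^sup>2 * p) + (1 / s * b + - 1 / s\<^sup>2 * q)) =
      (p - q) + l / s * (s\<^sup>2 * a) + 1 / s * (s\<^sup>2 * b)" if "s \<noteq> 0" for s a b p q :: real
    using that by (simp add: field_simps power2_eq_square)
  have "(l + 1)\<^sup>2 * ?d v = (val l (par v) - val l c) +
     l / (l + 1) * ((l + 1)\<^sup>2 * ?d (par v)) + 1 / (l + 1) * ((l + 1)\<^sup>2 * ?d c)"
    unfolding dv using l by (intro clear) simp
  then show ?thesis
    using gain_eq[OF l] openD[OF v] cV Delta_eq[OF l v c] by simp
qed

text \<open>A minimum principle: by \<open>gain_mean\<close> and \<open>Delta_pos\<close> the gain at an open vertex strictly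
  exceeds its minimum, so the minimum is attained at a leaf and is \<open>0\<close>.\<close>

lemma gain_pos:
  assumes l: "0 < l" and v: "v \<in> opens"
  shows "gain l v > 0"
proof -
  obtain u where u: "u \<in> V" "gain l u = Min (gain l ` V)"
    using Min_in[of "gain l ` V"] finite_V root_in by fastforce
  then have least: "gain l u \<le> gain l w" if "w \<in> V" for w using that finite_V by simp
  have more: "gain l w \<ge> Delta V E r l w + gain l u" if w: "w \<in> opens" for w
  proof -
    obtain c where c: "c \<in> V_minus V E r w" using V_minus_nonempty[OF w] by blast
    have "l / (l + 1) * gain l u + 1 / (l + 1) * gain l u 
        \<le> l / (l + 1) * gain l (par w) + 1 / (l + 1) * gain l c"
      using l least openD[OF w] V_minusD(1)[OF c] kidD by (intro add_mono mult_left_mono) auto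
    also have "l / (l + 1) * gain l u + 1 / (l + 1) * gain l u = (l / (l + 1) + 1 / (l + 1)) * gain l u"
      by (simp only: distrib_right)
    also have "l / (l + 1) + 1 / (l + 1) = 1" using l by (simp add: add_divide_distrib[symmetric])
    finally show ?thesis using gain_mean[OF l w c] by simp
  qed
  have "u \<notin> opens" using more[of u] Delta_pos[OF l, of u] by fastforce
  then have "gain l u = 0" using gain_leaf[OF l] u(1) by (simp add: open_vertices_def)
  then show ?thesis using more[OF v] Delta_pos[OF l v] by simp
qed

end


section \<open>Mean total variation of the process\<close>

lemma (in prob_space) event_eq:
  assumes "Y \<in> M \<rightarrow>\<^sub>M count_space V"
  shows "{\<omega>\<in>space M. Y \<omega> = z} \<in> events"
proof -
  have "Y -` ({z} \<inter> V) \<inter> space M \<in> events" by (rule measurable_sets[OF assms]) auto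
  also have "Y -` ({z} \<inter> V) \<inter> space M = {\<omega>\<in>space M. Y \<omega> = z}"
    using measurable_space[OF assms] by auto
  finally show ?thesis .
qed

text \<open>A transition probability that is the same for all histories ending in \<open>s\<close> is the transition
  probability from \<open>s\<close>: the event \<open>X k = s\<close> is the disjoint union of finitely many histories.\<close>

lemma (in prob_space) joint_from_history:
  fixes X :: "nat \<Rightarrow> 'a \<Rightarrow> 'v"
  assumes fin: "finite V" and X: "\<And>k. X k \<in> M \<rightarrow>\<^sub>M count_space V"
    and cond: "\<And>x. x k = s \<Longrightarrow> 0 < \<P>(\<omega> in M. \<forall>i\<le>k. X i \<omega> = x i) \<Longrightarrow>
      \<P>(\<omega> in M. X (Suc k) \<omega> = y \<bar> \<forall>i\<le>k. X i \<omega> = x i) = p"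
  shows "\<P>(\<omega> in M. X k \<omega> = s \<and> X (Suc k) \<omega> = y) = p * \<P>(\<omega> in M. X k \<omega> = s)"
proof -
  note ev = event_eq[OF X]
  define Hs where "Hs = {x \<in> PiE {..k} (\<lambda>_. V). x k = s}"
  define A where "A x = {\<omega>\<in>space M. \<forall>i\<le>k. X i \<omega> = x i}" for x
  define B where "B = {\<omega>\<in>space M. X (Suc k) \<omega> = y}"
  have finHs: "finite Hs" unfolding Hs_def using fin by (simp add: finite_PiE)
  have B: "B \<in> events" unfolding B_def by (rule ev)
  have A: "A x \<in> events" for x
  proof -
    have "{\<omega>\<in>space M. \<forall>i\<in>{..k}. X i \<omega> = x i} \<in> events"
      by (intro sets.sets_Collect_finite_All ev) simp
    also have "{\<omega>\<in>space M. \<forall>i\<in>{..k}. X i \<omega> = x i} = A x" by (auto simp: A_def)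
    finally show ?thesis .
  qed
  have disj: "disjoint_family_on A Hs"
    unfolding disjoint_family_on_def
  proof (intro ballI impI)
    fix x x' assume "x \<in> Hs" "x' \<in> Hs" "x \<noteq> x'"
    then have "\<exists>i\<in>{..k}. x i \<noteq> x' i"
      using PiE_ext[of x "{..k}" "\<lambda>_. V" x'] unfolding Hs_def by blast
    then show "A x \<inter> A x' = {}" unfolding A_def by force
  qed
  have un: "{\<omega>\<in>space M. X k \<omega> = s} = (\<Union>x\<in>Hs. A x)"
  proof (intro equalityI subsetI)
    fix \<omega> assume w: "\<omega> \<in> {\<omega>\<in>space M. X k \<omega> = s}"
    then have "restrict (\<lambda>i. X i \<omega>) {..k} \<in> Hs"
      using measurable_space[OF X] by (auto simp: Hs_def)
    moreover have "\<omega> \<in> A (restrict (\<lambda>i. X i \<omega>) {..k})" using w by (auto simp: A_def)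
    ultimately show "\<omega> \<in> (\<Union>x\<in>Hs. A x)" by blast
  qed (auto simp: A_def Hs_def)
  have each: "prob (A x \<inter> B) = p * prob (A x)" if "x \<in> Hs" for x
  \<comment> \<open>Histories of probability zero are exempt from \<open>cond\<close>, but both sides vanish for them.\<close>
  proof (cases "prob (A x) = 0")
    case True
    have "prob (A x \<inter> B) \<le> prob (A x)" by (rule finite_measure_mono) (use A in auto)
    with True show ?thesis by (simp add: measure_le_0_iff)
  next
    case False
    then have pos: "0 < prob (A x)" by (simp add: zero_less_measure_iff)
    have "A x \<inter> B = {\<omega>\<in>space M. X (Suc k) \<omega> = y \<and> (\<forall>i\<le>k. X i \<omega> = x i)}"
      by (auto simp: A_def B_def)
    then have "prob (A x \<inter> B) / prob (A x) = p"
      using cond[of x] pos that unfolding cond_prob_def A_def Hs_def by simp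
    then show ?thesis using pos by (simp add: field_simps)
  qed
  have "{\<omega>\<in>space M. X k \<omega> = s \<and> X (Suc k) \<omega> = y} = (\<Union>x\<in>Hs. A x \<inter> B)"
    using un by (auto simp: B_def)
  also have "prob \<dots> = (\<Sum>x\<in>Hs. prob (A x \<inter> B))"
    using A B disj by (intro finite_measure_finite_Union finHs) (auto simp: disjoint_family_on_def)
  also have "\<dots> = p * (\<Sum>x\<in>Hs. prob (A x))" by (simp add: each sum_distrib_left)
  also have "(\<Sum>x\<in>Hs. prob (A x)) = prob (\<Union>x\<in>Hs. A x)"
    using A disj by (intro finite_measure_finite_Union[symmetric] finHs) auto
  finally show ?thesis by (simp add: un)
qed

lemma (in prob_space) prob_split:
  assumes fin: "finite V" and Y: "Y \<in> M \<rightarrow>\<^sub>M count_space V" and A: "A \<in> events"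
  shows "(\<Sum>y\<in>V. prob {\<omega>\<in>A. Y \<omega> = y}) = prob A"
proof -
  have sub: "A \<subseteq> space M" using A by (rule sets.sets_into_space)
  have eq: "{\<omega>\<in>A. Y \<omega> = y} = A \<inter> {\<omega>\<in>space M. Y \<omega> = y}" for y using sub by auto
  have "prob (\<Union>y\<in>V. {\<omega>\<in>A. Y \<omega> = y}) = (\<Sum>y\<in>V. prob {\<omega>\<in>A. Y \<omega> = y})"
    using A event_eq[OF Y]
    by (intro finite_measure_finite_Union fin) (auto simp: disjoint_family_on_def eq)
  moreover have "(\<Union>y\<in>V. {\<omega>\<in>A. Y \<omega> = y}) = A"
    using measurable_space[OF Y] sub by auto
  ultimately show ?thesis by simp
qed

context reward_tree
begin

lemma less_finish_time_iff:
  assumes stay: "\<And>k. X k \<omega> \<in> leaves V E \<Longrightarrow> X (Suc k) \<omega> = X k \<omega>"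
  shows "enat i < finish_time V E X \<omega> \<longleftrightarrow> X i \<omega> \<notin> leaves V E"
proof
  assume "enat i < finish_time V E X \<omega>"
  then have "\<And>j. X j \<omega> \<in> leaves V E \<Longrightarrow> enat i < enat j"
    unfolding finish_time_def by (rule less_INF_D) simp
  then show "X i \<omega> \<notin> leaves V E" by fastforce
next
  assume i: "X i \<omega> \<notin> leaves V E"
  have "Suc i \<le> j" if j: "X j \<omega> \<in> leaves V E" for j
  proof (rule ccontr)
    assume "\<not> Suc i \<le> j"
    then have "j \<le> i" by simp
    then have "X i \<omega> \<in> leaves V E" by (induction rule: dec_induct) (use j stay in auto)
    then show False using i by simp
  qed
  then have "enat (Suc i) \<le> finish_time V E X \<omega>"
    unfolding finish_time_def by (intro INF_greatest) auto
  moreover have "enat i < enat (Suc i)" by simp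
  ultimately show "enat i < finish_time V E X \<omega>" by (rule less_le_trans[rotated])
qed

lemma finite_opens: "finite opens"
  using finite_V by (simp add: open_vertices_def)

text \<open>Almost surely a run stays at the first leaf it meets, so the times before \<open>finish_time\<close> are
  exactly the times spent at open vertices.\<close>

lemma mean_TotVar_eq_suminf:
  assumes l: "0 < l" and proc: "theta_process V E r \<epsilon> l \<theta> v M X"
  shows "mean_TotVar V E r l M X =
    (\<Sum>i. ennreal (\<Sum>x\<in>opens. \<P>(\<omega> in M. X i \<omega> = x) * Delta V E r l x))"
proof -
  interpret prob_space M using proc by (simp add: theta_process_def)
  have X: "X k \<in> M \<rightarrow>\<^sub>M count_space V" for k using proc by (simp add: theta_process_def)
  note ev = event_eq[OF X]
  have "AE \<omega> in M. \<forall>k. X k \<omega> \<in> leaves V E \<longrightarrow> X (Suc k) \<omega> = X k \<omega>"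
    using proc by (simp add: theta_process_def AE_all_countable)
  then have AE: "AE \<omega> in M. TotVar V E r l X \<omega> =
      (\<Sum>i. \<Sum>x\<in>opens. ennreal (Delta V E r l x) * indicator {\<omega>\<in>space M. X i \<omega> = x} \<omega>)"
  proof (rule AE_mp, intro AE_I2 impI)
    fix \<omega> assume w: "\<omega> \<in> space M" and stay: "\<forall>k. X k \<omega> \<in> leaves V E \<longrightarrow> X (Suc k) \<omega> = X k \<omega>"
    have "(if enat i < finish_time V E X \<omega> then ennreal (Delta V E r l (X i \<omega>)) else 0) =
      (\<Sum>x\<in>opens. ennreal (Delta V E r l x) * indicator {\<omega>\<in>space M. X i \<omega> = x} \<omega>)" for i
    proof -
      have "X i \<omega> \<in> V" using measurable_space[OF X w] by simp
      then have "enat i < finish_time V E X \<omega> \<longleftrightarrow> X i \<omega> \<in> opens"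
        using less_finish_time_iff[of X \<omega> i] stay by (simp add: open_vertices_def)
      moreover have "(\<Sum>x\<in>opens. ennreal (Delta V E r l x) * indicator {\<omega>\<in>space M. X i \<omega> = x} \<omega>)
        = (\<Sum>x\<in>opens. if X i \<omega> = x then ennreal (Delta V E r l x) else 0)"
        using w by (intro sum.cong) auto
      ultimately show ?thesis using finite_opens by simp
    qed
    then show "TotVar V E r l X \<omega> =
      (\<Sum>i. \<Sum>x\<in>opens. ennreal (Delta V E r l x) * indicator {\<omega>\<in>space M. X i \<omega> = x} \<omega>)"
      by (simp add: TotVar_def)
  qed
  have "mean_TotVar V E r l M X =
    (\<integral>\<^sup>+\<omega>. (\<Sum>i. \<Sum>x\<in>opens. ennreal (Delta V E r l x) * indicator {\<omega>\<in>space M. X i \<omega> = x} \<omega>) \<partial>M)"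
    unfolding mean_TotVar_def by (rule nn_integral_cong_AE[OF AE])
  also have "\<dots> = (\<Sum>i. \<Sum>x\<in>opens. ennreal (Delta V E r l x) * emeasure M {\<omega>\<in>space M. X i \<omega> = x})"
    using ev by (subst nn_integral_suminf)
      (auto simp: nn_integral_sum nn_integral_cmult_indicator intro!: borel_measurable_sum borel_measurable_times_ennreal)
  also have "\<dots> = (\<Sum>i. ennreal (\<Sum>x\<in>opens. \<P>(\<omega> in M. X i \<omega> = x) * Delta V E r l x))"
    using Delta_pos[OF l]
    by (intro suminf_cong, subst sum_ennreal[symmetric])
       (auto simp: emeasure_eq_measure ennreal_mult' mult.commute less_imp_le intro!: sum.cong)
  finally show ?thesis .
qed

text \<open>The choice made by \<open>\<theta>\<close> does not matter because \<open>gain_mean\<close> holds for every element of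
  \<open>V_minus\<close>. Sums over open vertices suffice, as the gain vanishes on leaves.\<close>

lemma expected_step:
  assumes l: "0 < l" and th: "\<theta> \<in> Theta V E r"
    and proc: "theta_process V E r \<epsilon> l \<theta> v M X"
  shows "(\<Sum>y\<in>opens. \<P>(\<omega> in M. X (Suc k) \<omega> = y) * gain l y) =
    (\<Sum>x\<in>opens. \<P>(\<omega> in M. X k \<omega> = x) * (gain l x - \<epsilon> * Delta V E r l x))"
proof -
  interpret prob_space M using proc by (simp add: theta_process_def)
  have X: "X k \<in> M \<rightarrow>\<^sub>M count_space V" for k using proc by (simp add: theta_process_def)
  note ev = event_eq[OF X]
  define q where "q x = \<P>(\<omega> in M. X k \<omega> = x)" for x
  define j where "j x y = \<P>(\<omega> in M. X k \<omega> = x \<and> X (Suc k) \<omega> = y)" for x y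
  have j_nonneg: "0 \<le> j x y" for x y by (simp add: j_def)
  have from_sum: "(\<Sum>y\<in>V. j x y) = q x" for x
    using prob_split[OF finite_V X[of "Suc k"] ev[of k x]] by (simp add: j_def q_def conj_ac)
  have to_sum: "(\<Sum>x\<in>V. j x y) = \<P>(\<omega> in M. X (Suc k) \<omega> = y)" for y
    using prob_split[OF finite_V X[of k] ev[of "Suc k" y]] by (simp add: j_def conj_ac)
  have from_leaf: "(\<Sum>y\<in>V. j x y * gain l y) = 0" if x: "x \<in> leaves V E" for x
  proof -
    have "j x y * gain l y = 0" for y
    proof (cases "y = x")
      case False
      have "AE \<omega> in M. \<not> (X k \<omega> = x \<and> X (Suc k) \<omega> = y)"
        using proc x False unfolding theta_process_def by (auto elim!: AE_mp)
      then have "j x y = 0" unfolding j_def by (rule prob_eq_0_AE)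
      then show ?thesis by simp
    qed (simp add: gain_leaf[OF l x])
    then show ?thesis by (intro sum.neutral) blast
  qed
  have from_open: "(\<Sum>y\<in>V. j x y * gain l y) = q x * (gain l x - \<epsilon> * Delta V E r l x)"
    if x: "x \<in> opens" for x
  proof -
    note xV = openD[OF x]
    define c where "c = \<theta> l x k"
    have c: "c \<in> V_minus V E r x" using th l x by (simp add: c_def Theta_def)
    have ne: "x \<noteq> par x" "x \<noteq> c" "c \<noteq> par x" "c \<in> V"
      using parent_in[OF finite_tree root_in xV(1,2)]
        child_neq[OF finite_tree root_in xV(1,2) V_minusD(1)[OF c]] by auto
    have jx: "j x x = (1 - \<epsilon>) * q x" "j x (par x) = \<epsilon> * (l / (1 + l)) * q x"
        "j x c = \<epsilon> * (1 / (1 + l)) * q x"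
      unfolding j_def q_def c_def
      by (rule joint_from_history[OF finite_V X]; use proc x in \<open>auto simp: theta_process_def\<close>)+
    \<comment> \<open>The three possible moves from \<open>x\<close> have total probability one, so no other vertex is reached.\<close>
    define T where "T = {x, par x, c}"
    have T: "T \<subseteq> V" using xV ne by (simp add: T_def)
    have sT: "(\<Sum>y\<in>T. f y) = f x + f (par x) + f c" for f :: "'v \<Rightarrow> real"
      using ne by (simp add: T_def add.assoc)
    have "l / (1 + l) + 1 / (1 + l) = 1" using l by (simp add: add_divide_distrib[symmetric])
    then have "\<epsilon> * (l / (1 + l)) + \<epsilon> * (1 / (1 + l)) = \<epsilon>" by (metis distrib_left mult.right_neutral)
    then have "(\<Sum>y\<in>T. j x y) = q x"
      unfolding sT jx by (metis add.assoc diff_add_cancel distrib_right mult_1)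
    then have "(\<Sum>y\<in>V - T. j x y) = 0"
      using from_sum[of x] sum.subset_diff[OF T finite_V, of "j x"] by simp
    then have "\<forall>y\<in>V - T. j x y = 0"
      using finite_V j_nonneg by (subst (asm) sum_nonneg_eq_0_iff) auto
    then have "(\<Sum>y\<in>V. j x y * gain l y) = (\<Sum>y\<in>T. j x y * gain l y)"
      using T finite_V by (intro sum.mono_neutral_right) auto
    also have "\<dots> = q x * (gain l x - \<epsilon> *
        (gain l x - l / (l + 1) * gain l (par x) - 1 / (l + 1) * gain l c))"
      unfolding sT jx by (simp add: algebra_simps)
    also have "gain l x - l / (l + 1) * gain l (par x) - 1 / (l + 1) * gain l c = Delta V E r l x"
      using gain_mean[OF l x c] by simp
    finally show ?thesis .
  qed
  have split: "(\<Sum>x\<in>V. f x) = (\<Sum>x\<in>opens. f x)" if "\<And>x. x \<in> leaves V E \<Longrightarrow> f x = 0"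
    for f :: "'v \<Rightarrow> real"
    using that finite_V by (intro sum.mono_neutral_right) (auto simp: open_vertices_def)
  have "(\<Sum>y\<in>opens. \<P>(\<omega> in M. X (Suc k) \<omega> = y) * gain l y) = (\<Sum>y\<in>V. (\<Sum>x\<in>V. j x y) * gain l y)"
    using gain_leaf[OF l] by (subst split) (auto simp: to_sum)
  also have "\<dots> = (\<Sum>x\<in>V. \<Sum>y\<in>V. j x y * gain l y)"
    by (simp add: sum_distrib_right) (rule sum.swap)
  also have "\<dots> = (\<Sum>x\<in>opens. q x * (gain l x - \<epsilon> * Delta V E r l x))"
    using from_leaf from_open by (subst split) auto
  finally show ?thesis by (simp add: q_def)
qed

text \<open>With \<open>d k\<close> the mean contribution of time \<open>k\<close> to the total variation and \<open>m k\<close> the mean gain at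
  time \<open>k\<close>, the one-step identity telescopes to \<open>\<epsilon> * (\<Sum>i<n. d i) = gain l v - m n\<close>. The left side
  is thus bounded, so \<open>d\<close> is summable and tends to \<open>0\<close>, and with it \<open>m\<close>, which is at most a
  constant multiple of \<open>d\<close>.\<close>

lemma mean_TotVar_eq_gain:
  assumes l: "0 < l" and e: "0 < \<epsilon>" and v: "v \<in> opens" and th: "\<theta> \<in> Theta V E r"
    and proc: "theta_process V E r \<epsilon> l \<theta> v M X"
  shows "mean_TotVar V E r l M X = ennreal (gain l v / \<epsilon>)"
proof -
  interpret prob_space M using proc by (simp add: theta_process_def)
  define q where "q k x = \<P>(\<omega> in M. X k \<omega> = x)" for k x
  define d where "d k = (\<Sum>x\<in>opens. q k x * Delta V E r l x)" for k
  define m where "m k = (\<Sum>x\<in>opens. q k x * gain l x)" for k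
  have q_nonneg: "0 \<le> q k x" for k x by (simp add: q_def)
  have d_nonneg: "0 \<le> d k" for k
    using Delta_pos[OF l] q_nonneg by (auto simp: d_def less_imp_le intro!: sum_nonneg)
  have m_nonneg: "0 \<le> m k" for k
    using gain_pos[OF l] q_nonneg by (auto simp: m_def less_imp_le intro!: sum_nonneg)
  have m_Suc: "m (Suc k) = m k - \<epsilon> * d k" for k
    using expected_step[OF l th proc, of k]
    by (simp add: m_def d_def q_def algebra_simps sum_subtractf sum_distrib_left)
  have m_0: "m 0 = gain l v"
  proof -
    have X0: "AE \<omega> in M. X 0 \<omega> = v" using proc by (simp add: theta_process_def)
    have "q 0 x = (if x = v then 1 else 0)" for x
    proof (cases "x = v")
      case True
      have "X 0 \<in> M \<rightarrow>\<^sub>M count_space V" using proc by (simp add: theta_process_def)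
      from prob_Collect_eq_1[OF event_eq[OF this]] X0 True show ?thesis by (simp add: q_def)
    next
      case False
      then have "AE \<omega> in M. X 0 \<omega> \<noteq> x" using X0 by (auto elim!: AE_mp)
      then show ?thesis unfolding q_def using prob_eq_0_AE False by simp
    qed
    then show ?thesis using v finite_opens by (simp add: m_def if_distrib[of "\<lambda>a. a * _"] cong: if_cong)
  qed
  have partial: "\<epsilon> * (\<Sum>i<n. d i) = gain l v - m n" for n
    by (induction n) (simp_all add: m_0 m_Suc distrib_left)
  then have "(\<Sum>i<n. d i) \<le> gain l v / \<epsilon>" for n
    using m_nonneg[of n] e by (simp add: pos_le_divide_eq mult.commute)
  then have "summable d" using d_nonneg by (intro summableI_nonneg_bounded)
  then have d0: "d \<longlonglongrightarrow> 0" by (rule summable_LIMSEQ_zero)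
  \<comment> \<open>The sum bounds each of the ratios, hence \<open>gain \<le> C * Delta\<close> on the open vertices.\<close>
  define C where "C = (\<Sum>x\<in>opens. gain l x / Delta V E r l x)"
  have "m k \<le> C * d k" for k
  proof -
    have "gain l x \<le> C * Delta V E r l x" if x: "x \<in> opens" for x
    proof -
      have "gain l x / Delta V E r l x \<le> C"
        unfolding C_def using gain_pos[OF l] Delta_pos[OF l] x
        by (intro member_le_sum finite_opens) (auto simp: less_imp_le)
      then show ?thesis using Delta_pos[OF l x] by (simp add: pos_divide_le_eq)
    qed
    then have "m k \<le> (\<Sum>x\<in>opens. q k x * (C * Delta V E r l x))"
      unfolding m_def using q_nonneg by (intro sum_mono mult_left_mono)
    also have "\<dots> = C * d k" by (simp add: d_def sum_distrib_left mult_ac)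
    finally show ?thesis .
  qed
  then have m_le: "eventually (\<lambda>k. m k \<le> C * d k) sequentially" by (intro always_eventually allI)
  have Cd0: "(\<lambda>k. C * d k) \<longlonglongrightarrow> 0" using tendsto_mult_left[OF d0, of C] by simp
  have "eventually (\<lambda>k. 0 \<le> m k) sequentially" using m_nonneg by (intro always_eventually allI)
  then have m0: "m \<longlonglongrightarrow> 0" by (rule tendsto_sandwich[OF _ m_le tendsto_const Cd0])
  have "(\<Sum>i<n. d i) = (gain l v - m n) / \<epsilon>" for n
    unfolding partial[symmetric] using e by simp
  moreover have "(\<lambda>n. (gain l v - m n) / \<epsilon>) \<longlonglongrightarrow> (gain l v - 0) / \<epsilon>"
    using e by (intro tendsto_divide tendsto_diff tendsto_const m0) simp
  ultimately have "d sums (gain l v / \<epsilon>)" by (simp add: sums_def)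
  then have "(\<Sum>i. ennreal (d i)) = ennreal (gain l v / \<epsilon>)"
    using d_nonneg by (intro suminf_ennreal_eq)
  then show ?thesis using mean_TotVar_eq_suminf[OF l proc] by (simp add: d_def q_def)
qed

end

theorem proposition1p17:
  fixes V :: "'v set" and E :: "'v set set" and r v :: 'v and l :: real
  assumes "root_reward_tree V E r" and "0 < l" and "v \<in> open_vertices V E"
  shows "\<exists>ETV :: real \<Rightarrow> real. \<forall>\<epsilon>\<in>{0<..1}.
           (\<forall>\<theta>\<in>Theta V E r. \<forall>(M :: 'w measure) X.
              theta_process V E r \<epsilon> l \<theta> v M X \<longrightarrow> mean_TotVar V E r l M X = ennreal (ETV \<epsilon>)) \<and>
           ETV \<epsilon> > 0 \<and>
           ETV \<epsilon> = inverse \<epsilon> * (l + 1)\<^sup>2 * deriv (\<lambda>l. h V E r l v) l \<and>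
           Stake V E r \<epsilon> l v = Delta V E r l v / ETV \<epsilon> \<and>
           Stake V E r \<epsilon> l v = \<epsilon> * Delta V E r l v / ETV 1"
proof (intro exI ballI conjI allI impI)
  interpret reward_tree V E r by unfold_locales (rule assms(1))
  let ?ETV = "\<lambda>\<epsilon>. inverse \<epsilon> * (l + 1)\<^sup>2 * deriv (\<lambda>l. h V E r l v) l"
  have ETV: "?ETV \<epsilon> = gain l v / \<epsilon>" for \<epsilon> by (simp add: gain_def field_simps)
  fix \<epsilon> :: real assume "\<epsilon> \<in> {0<..1}"
  then have e: "0 < \<epsilon>" by simp
  show "?ETV \<epsilon> > 0" unfolding ETV using gain_pos[OF assms(2,3)] e by simp
  show "mean_TotVar V E r l M X = ennreal (?ETV \<epsilon>)"
    if "\<theta> \<in> Theta V E r" "theta_process V E r \<epsilon> l \<theta> v M X" for \<theta> and M :: "'w measure" and X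
    unfolding ETV using mean_TotVar_eq_gain[OF assms(2) e assms(3) that] .
  show "?ETV \<epsilon> = inverse \<epsilon> * (l + 1)\<^sup>2 * deriv (\<lambda>l. h V E r l v) l" by (rule refl)
  show "Stake V E r \<epsilon> l v = Delta V E r l v / ?ETV \<epsilon>"
    unfolding ETV by (simp add: Stake_def gain_def field_simps)
  show "Stake V E r \<epsilon> l v = \<epsilon> * Delta V E r l v / ?ETV 1"
    by (simp add: Stake_def)
qed

end
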